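(* Let $C$ be an $\mathrm{HFP}(t,Q_{\mathbf u})$-code of length $4t$, where $t$ is odd. Then its rank is $r=4t-1$ and the dimension of its kernel is $k=1$.
   Context: Let $\mathbb F$ be the binary field. $C_m$ denotes the cyclic group of order $m$. $\mathbf e$ is the all-zero vector and $\mathbf u$ the all-one vector. For $\pi\in S_n$ and $x\in\mathbb F^n$, $\pi(x)=(x_{\pi^{-1}(1)},\ldots,x_{\pi^{-1}(n)})$. A Hadamard code of length $n=4t$ is a set of $2n$ binary vectors consisting of the rows of a binary Hadamard matrix (a Hadamard matrix with $1$ replaced by $0$ and $-1$ replaced by $1$) and their complements. All codes are assumed to contain $\mathbf e$. A binary code $C\subseteq\mathbb F^n$ has a propelinear structure if for each $x\in C$ there is $\pi_x\in S_n$ such that for all $y\in C$: $x+\pi_x(y)\in C$, and $\pi_x\pi_y=\pi_z$ where $z=x+\pi_x(y)$. Then $C$ is a group under $x*y=x+\pi_x(y)$ (written multiplicatively), with identity $\mathbf e$. A Hadamard full propelinear code (HFP-code) is a Hadamard code with a propelinear structure such that $\pi_x$ has no fixed coordinate for every $x\in C\setminus\{\mathbf e,\mathbf u\}$, and $\pi_{\mathbf e}=\pi_{\mathbf u}=I$. An $\mathrm{HFP}(t,Q_{\mathbf u})$-code of length $4t$ is an HFP-code $C=\langle d\rangle\times\langle a,b\rangle\simeq C_t\times Q$ with $d^t=\mathbf e$, $a^2=b^2=\mathbf u$, $aba=b$, where $Q$ is the quaternion group of order $8$. The rank $r$ of $C$ is the dimension of its linear span; the kernel is $K(C)=\{z\in\mathbb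 F^n : C+z=C\}$, a linear subspace contained in $C$, and $k=\dim K(C)$.
   Formalization: The kernel claim k=1 is stated only for odd t other than 1; for t=1 an HFP(1,Q_u)-code is the linear code of all even-weight vectors of length 4, whose kernel has dimension 3. The rank claim covers every odd t. *)

theory Defs
  imports
    "HOL-Analysis.Cartesian_Space"
    "HOL-Library.Z2"
    "HOL-Algebra.Elementary_Groups"
begin

text \<open>
  Binary vectors of length \<open>n\<close> are elements of \<open>bit ^ 'n\<close> with \<open>CARD('n) = n\<close>; the vectors
  \<open>e\<close> (all-zero) and \<open>u\<close> (all-one) are \<open>0\<close> and \<open>1\<close> of this type, and the complement of
  \<open>x\<close> is \<open>x + 1\<close>.
\<close>

definition hadamard_matrix :: "int ^ 'n ^ 'n \<Rightarrow> bool" where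
  "hadamard_matrix H \<longleftrightarrow>
     (\<forall>i j. H $ i $ j = 1 \<or> H $ i $ j = -1) \<and>
     H ** transpose H = mat (int CARD('n))"

definition binary_matrix :: "int ^ 'n ^ 'm \<Rightarrow> bit ^ 'n ^ 'm" where
  "binary_matrix H = (\<chi> i j. if H $ i $ j = 1 then 0 else 1)"

definition hadamard_code :: "(bit ^ 'n) set \<Rightarrow> bool" where
  "hadamard_code C \<longleftrightarrow>
     (\<exists>H :: int ^ 'n ^ 'n. hadamard_matrix H \<and>
        C = range (\<lambda>i. row i (binary_matrix H)) \<union> range (\<lambda>i. row i (binary_matrix H) + 1))"

definition permute_coords :: "('n \<Rightarrow> 'n) \<Rightarrow> bit ^ 'n \<Rightarrow> bit ^ 'n" where
  "permute_coords \<sigma> x = (\<chi> i. x $ (inv_into UNIV \<sigma> i))"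

definition propelinear_mult ::
    "(bit ^ 'n \<Rightarrow> 'n \<Rightarrow> 'n) \<Rightarrow> bit ^ 'n \<Rightarrow> bit ^ 'n \<Rightarrow> bit ^ 'n" where
  "propelinear_mult \<pi> x y = x + permute_coords (\<pi> x) y"

definition propelinear_structure ::
    "(bit ^ 'n \<Rightarrow> 'n \<Rightarrow> 'n) \<Rightarrow> (bit ^ 'n) set \<Rightarrow> bool" where
  "propelinear_structure \<pi> C \<longleftrightarrow>
     (\<forall>x\<in>C. bij (\<pi> x)) \<and>
     (\<forall>x\<in>C. \<forall>y\<in>C. propelinear_mult \<pi> x y \<in> C \<and>
        \<pi> x \<circ> \<pi> y = \<pi> (propelinear_mult \<pi> x y))"

definition propelinear_group ::
    "(bit ^ 'n \<Rightarrow> 'n \<Rightarrow> 'n) \<Rightarrow> (bit ^ 'n) set \<Rightarrow> (bit ^ 'n) monoid" where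
  "propelinear_group \<pi> C = \<lparr>carrier = C, mult = propelinear_mult \<pi>, one = 0\<rparr>"

definition HFP_code :: "(bit ^ 'n \<Rightarrow> 'n \<Rightarrow> 'n) \<Rightarrow> (bit ^ 'n) set \<Rightarrow> bool" where
  "HFP_code \<pi> C \<longleftrightarrow>
     hadamard_code C \<and> 0 \<in> C \<and> propelinear_structure \<pi> C \<and>
     (\<forall>x \<in> C - {0, 1}. \<forall>i. \<pi> x i \<noteq> i) \<and> \<pi> 0 = id \<and> \<pi> 1 = id"

text \<open>
  The quaternion group \<open>{\<plusminus>1, \<plusminus>i, \<plusminus>j, \<plusminus>k}\<close>; the tuple \<open>(r, x, y, z)\<close> stands for the
  Hamilton quaternion \<open>r + x i + y j + z k\<close>.
\<close>

definition quaternion_mult ::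
    "int \<times> int \<times> int \<times> int \<Rightarrow> int \<times> int \<times> int \<times> int \<Rightarrow> int \<times> int \<times> int \<times> int" where
  "quaternion_mult = (\<lambda>(r, x, y, z) (r', x', y', z').
     (r * r' - x * x' - y * y' - z * z',
      r * x' + x * r' + y * z' - z * y',
      r * y' - x * z' + y * r' + z * x',
      r * z' + x * y' - y * x' + z * r'))"

definition quaternion_group :: "(int \<times> int \<times> int \<times> int) monoid" where
  "quaternion_group =
     \<lparr>carrier = (\<Union>s\<in>{1, -1}. {(s, 0, 0, 0), (0, s, 0, 0), (0, 0, s, 0), (0, 0, 0, s)}),
      mult = quaternion_mult, one = (1, 0, 0, 0)\<rparr>"

text \<open>
  Bijectivity and multiplicativity of \<open>(x, y) \<mapsto> x \<otimes> y\<close> say that \<open>C\<close> is the internal direct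
  product of \<open>\<langle>d\<rangle>\<close> and \<open>\<langle>a, b\<rangle>\<close>.
\<close>

definition HFP_Qu_code ::
    "nat \<Rightarrow> (bit ^ 'n \<Rightarrow> 'n \<Rightarrow> 'n) \<Rightarrow> (bit ^ 'n) set \<Rightarrow> bool" where
  "HFP_Qu_code t \<pi> C \<longleftrightarrow>
     CARD('n) = 4 * t \<and> HFP_code \<pi> C \<and>
     (let G = propelinear_group \<pi> C in
      \<exists>d\<in>C. \<exists>a\<in>C. \<exists>b\<in>C.
        (\<lambda>(x, y). x \<otimes>\<^bsub>G\<^esub> y)
          \<in> iso (subgroup_generated G {d} \<times>\<times> subgroup_generated G {a, b}) G \<and>
        subgroup_generated G {d} \<cong> integer_mod_group t \<and>
        subgroup_generated G {a, b} \<cong> quaternion_group \<and>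
        d [^]\<^bsub>G\<^esub> t = 0 \<and>
        a \<otimes>\<^bsub>G\<^esub> a = 1 \<and> b \<otimes>\<^bsub>G\<^esub> b = 1 \<and>
        a \<otimes>\<^bsub>G\<^esub> b \<otimes>\<^bsub>G\<^esub> a = b)"

definition code_rank :: "(bit ^ 'n) set \<Rightarrow> nat" where
  "code_rank C = vec.dim (vec.span C)"

definition code_kernel :: "(bit ^ 'n) set \<Rightarrow> (bit ^ 'n) set" where
  "code_kernel C = {z. (\<lambda>c. c + z) ` C = C}"

end

theory Submission
  imports Defs
begin

text \<open>
  Both numbers are forced by the Hadamard property and the length \<open>n = 4t\<close> with \<open>t\<close> odd. Replace
  each bit by its sign \<open>\<plusminus>1\<close>, so that addition of codewords becomes entrywise multiplication and
  distinct, non-complementary codewords become orthogonal integer vectors.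

  Rank. A codeword has even weight, because its signs sum to a multiple of 4; so the rank is at most
  \<open>n - 1\<close>. For the converse it suffices that only \<open>0\<close> and \<open>1\<close> are orthogonal to all codewords
  (\<open>hadamard_code_dual\<close>): a unit vector lies outside the span of \<open>C\<close>, and adjoining it leaves only
  \<open>0\<close> orthogonal to everything. Let \<open>S\<close> be the support of a vector in the dual, let \<open>s\<close> be its
  size, which is even, and let \<open>w = H \<chi>\<close> with \<open>\<chi>\<close> the indicator of \<open>S\<close>. Duality says that
  \<open>w\<^sub>i \<equiv> s\<close> modulo 4 for all \<open>i\<close>. If \<open>s \<equiv> 2\<close>, then each \<open>w\<^sub>i\<^sup>2\<close> is 4 modulo 16, and Parseval's
  identity \<open>\<Sum> w\<^sub>i\<^sup>2 = 4ts\<close> makes \<open>ts\<close> a multiple of 4, which is absurd. So \<open>w = 4k\<close>, and the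
  inversion formula \<open>H\<^sup>T w = 4t\<chi>\<close> becomes \<open>H\<^sup>T k = t\<chi>\<close>. Modulo 2 all entries of \<open>H\<close> are 1, so
  the left side has the same parity in each coordinate; as \<open>t\<close> is odd, \<open>\<chi>\<close> is constant.

  Kernel, for \<open>t \<noteq> 1\<close>. Let \<open>z\<close> be a kernel vector other than \<open>0\<close> and \<open>1\<close>. As \<open>C\<close> has more than 8
  elements, there are codewords \<open>c\<close> and \<open>c'\<close> such that \<open>0, z, c, c'\<close> and also \<open>c + z, c'\<close> are
  pairwise neither equal nor complementary.
  Expanding the product and using orthogonality, with \<open>\<sigma>\<close> for the sign, the sum over the coordinates
  of \<open>(1 + \<sigma>(z))(1 + \<sigma>(c))(1 + \<sigma>(c'))\<close> equals \<open>4t\<close>. Each summand is 0 or 8, which contradicts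
  that \<open>t\<close> is odd.
\<close>

section \<open>Signs of bits\<close>

definition bit_sign :: "bit \<Rightarrow> int" where
  "bit_sign b = (if b = 0 then 1 else -1)"

lemma bit_sign_simps [simp]: "bit_sign 0 = 1" "bit_sign 1 = -1"
  by (simp_all add: bit_sign_def)

lemma bit_sign_add: "bit_sign (a + b) = bit_sign a * bit_sign b"
  by (cases a; cases b) simp_all

lemma bit_sign_eq_iff: "bit_sign a = bit_sign b \<longleftrightarrow> a = b"
  by (cases a; cases b) simp_all

lemma bit_sign_complement: "bit_sign ((x + 1) $ j) = - bit_sign (x $ j)"
  by (cases "x $ j") simp_all

text \<open>
  Changing a bit from 0 to 1 lowers the sum of signs by 2, so the number of ones is determined modulo
  2 by the sum of signs modulo 4. This is how linear conditions over the binary field enter the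
  integer arithmetic of a Hadamard matrix.
\<close>

lemma sum_eq_0_iff_sum_bit_sign_mod_4:
  fixes c :: "'a \<Rightarrow> bit"
  assumes "finite S"
  shows "(\<Sum>j\<in>S. c j) = 0 \<longleftrightarrow> 4 dvd (\<Sum>j\<in>S. bit_sign (c j)) - int (card S)"
proof -
  have "4 dvd (\<Sum>j\<in>S. bit_sign (c j)) - int (card S) + 2 * of_bool ((\<Sum>j\<in>S. c j) \<noteq> 0)"
    using assms
  proof (induction S rule: finite_induct)
    case (insert x S)
    show ?case
      using insert by (cases "c x"; cases "sum c S") (simp_all; presburger)+
  qed simp
  then show ?thesis
    by (cases "(\<Sum>j\<in>S. c j)") (simp_all; presburger)+
qed

section \<open>Hadamard matrices and their codes\<close>

lemma hadamard_matrix_entry: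
  assumes "hadamard_matrix H"
  shows "H $ i $ j = 1 \<or> H $ i $ j = -1"
  using assms by (simp add: hadamard_matrix_def)

lemma hadamard_matrix_rows:
  fixes H :: "int ^ 'n ^ 'n"
  assumes "hadamard_matrix H"
  shows "(\<Sum>j\<in>UNIV. H $ i $ j * H $ k $ j) = (if i = k then int CARD('n) else 0)"
  using assms
  by (simp add: hadamard_matrix_def matrix_matrix_mult_def transpose_def mat_def vec_eq_iff)

text \<open>
  Over the reals \<open>H\<^sup>T / n\<close> is a right inverse of \<open>H\<close>, hence also a left inverse.
\<close>

lemma hadamard_matrix_columns:
  fixes H :: "int ^ 'n ^ 'n"
  assumes "hadamard_matrix H"
  shows "(\<Sum>i\<in>UNIV. H $ i $ j * H $ i $ k) = (if j = k then int CARD('n) else 0)"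
proof -
  define A :: "real ^ 'n ^ 'n" where "A = (\<chi> i j. of_int (H $ i $ j))"
  define B :: "real ^ 'n ^ 'n" where "B = (\<chi> i j. of_int (H $ j $ i) / of_nat CARD('n))"
  have "(\<Sum>l\<in>UNIV. A $ i $ l * B $ l $ m) = of_bool (i = m)" for i m
  proof -
    have "(\<Sum>l\<in>UNIV. A $ i $ l * B $ l $ m)
        = of_int (\<Sum>l\<in>UNIV. H $ i $ l * H $ m $ l) / of_nat CARD('n)"
      by (simp add: A_def B_def sum_divide_distrib)
    then show ?thesis
      by (simp add: hadamard_matrix_rows[OF assms])
  qed
  then have "A ** B = mat 1"
    by (simp add: matrix_matrix_mult_def mat_def vec_eq_iff)
  then have "B ** A = mat 1"
    by (simp add: matrix_left_right_inverse)
  then have "(\<Sum>i\<in>UNIV. B $ j $ i * A $ i $ k) = of_bool (j = k)"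
    by (simp add: matrix_matrix_mult_def mat_def vec_eq_iff)
  moreover have "(\<Sum>i\<in>UNIV. B $ j $ i * A $ i $ k)
      = of_int (\<Sum>i\<in>UNIV. H $ i $ j * H $ i $ k) / of_nat CARD('n)"
    by (simp add: A_def B_def sum_divide_distrib)
  ultimately have "real_of_int (\<Sum>i\<in>UNIV. H $ i $ j * H $ i $ k)
      = of_int (if j = k then int CARD('n) else 0)"
    by (cases "j = k") (simp_all add: field_simps)
  then show ?thesis
    by (simp only: of_int_eq_iff)
qed

text \<open>
  Membership in terms of signs makes the two halves of the code, rows and complements of rows, differ
  only by a global sign.
\<close>

lemma hadamard_codeE:
  fixes C :: "(bit ^ 'n) set"
  assumes "hadamard_code C"
  obtains H :: "int ^ 'n ^ 'n"
  where "hadamard_matrix H"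
    and "\<And>c. c \<in> C \<longleftrightarrow>
      (\<exists>i. (\<forall>j. bit_sign (c $ j) = H $ i $ j) \<or> (\<forall>j. bit_sign (c $ j) = - H $ i $ j))"
proof -
  obtain H :: "int ^ 'n ^ 'n" where H: "hadamard_matrix H"
    and C: "C = range (\<lambda>i. row i (binary_matrix H)) \<union> range (\<lambda>i. row i (binary_matrix H) + 1)"
    using assms unfolding hadamard_code_def by blast
  have sgn: "bit_sign (row i (binary_matrix H) $ j) = H $ i $ j" for i j
    using hadamard_matrix_entry[OF H, of i j] by (auto simp: row_def binary_matrix_def)
  have row: "c = row i (binary_matrix H) \<longleftrightarrow> (\<forall>j. bit_sign (c $ j) = H $ i $ j)" for c i
    by (simp add: vec_eq_iff bit_sign_eq_iff flip: sgn)
  have compl: "c = row i (binary_matrix H) + 1 \<longleftrightarrow> (\<forall>j. bit_sign (c $ j) = - H $ i $ j)" for c i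
  proof -
    have "bit_sign ((row i (binary_matrix H) + 1) $ j) = - H $ i $ j" for j
      by (simp only: bit_sign_complement sgn)
    then show ?thesis
      unfolding vec_eq_iff by (simp only: bit_sign_eq_iff[symmetric])
  qed
  show thesis
    by (rule that[OF H]) (auto simp: C simp flip: row compl)
qed

lemma hadamard_code_complement:
  fixes C :: "(bit ^ 'n) set"
  assumes "hadamard_code C" and "c \<in> C"
  shows "c + 1 \<in> C"
proof -
  obtain H :: "int ^ 'n ^ 'n" where C: "\<And>c. c \<in> C \<longleftrightarrow>
      (\<exists>i. (\<forall>j. bit_sign (c $ j) = H $ i $ j) \<or> (\<forall>j. bit_sign (c $ j) = - H $ i $ j))"
    using assms(1) by (rule hadamard_codeE) blast
  show ?thesis
    using assms(2) unfolding C bit_sign_complement by auto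
qed

lemma hadamard_code_orthogonal:
  fixes C :: "(bit ^ 'n) set"
  assumes "hadamard_code C" and "c \<in> C" and "c' \<in> C" and "c' \<noteq> c" and "c' \<noteq> c + 1"
  shows "(\<Sum>j\<in>UNIV. bit_sign (c $ j) * bit_sign (c' $ j)) = 0"
proof -
  obtain H :: "int ^ 'n ^ 'n" where H: "hadamard_matrix H"
    and C: "\<And>c. c \<in> C \<longleftrightarrow>
      (\<exists>i. (\<forall>j. bit_sign (c $ j) = H $ i $ j) \<or> (\<forall>j. bit_sign (c $ j) = - H $ i $ j))"
    using assms(1) by (rule hadamard_codeE) blast
  have signed: "\<exists>i s. (s = 1 \<or> s = -1) \<and> (\<forall>j. bit_sign (c $ j) = s * H $ i $ j)"
    if "c \<in> C" for c
    using that unfolding C by (metis mult_1 mult_minus1)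
  obtain i s where i: "s = 1 \<or> s = -1" "\<And>j. bit_sign (c $ j) = s * H $ i $ j"
    using signed[OF assms(2)] by blast
  obtain k r where k: "r = 1 \<or> r = -1" "\<And>j. bit_sign (c' $ j) = r * H $ k $ j"
    using signed[OF assms(3)] by blast
  have "i \<noteq> k"
  proof
    assume "i = k"
    then have "(\<forall>j. bit_sign (c' $ j) = bit_sign (c $ j))
        \<or> (\<forall>j. bit_sign (c' $ j) = bit_sign ((c + 1) $ j))"
      unfolding bit_sign_complement using i k by auto
    then show False
      using assms(4,5) unfolding bit_sign_eq_iff vec_eq_iff by blast
  qed
  have "(\<Sum>j\<in>UNIV. bit_sign (c $ j) * bit_sign (c' $ j))
      = s * r * (\<Sum>j\<in>UNIV. H $ i $ j * H $ k $ j)"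
    by (simp add: i k sum_distrib_left mult_ac)
  then show ?thesis
    using \<open>i \<noteq> k\<close> by (simp add: hadamard_matrix_rows[OF H])
qed

text \<open>
  The rows of a Hadamard matrix are distinct, so the code has at least as many elements as
  coordinates. The form below serves to choose codewords in general position.
\<close>

lemma hadamard_code_element_outside:
  fixes C :: "(bit ^ 'n) set"
  assumes "hadamard_code C" and "finite Y" and "card Y < CARD('n)"
  shows "\<exists>c\<in>C. c \<notin> Y"
proof (rule ccontr)
  assume "\<not> ?thesis"
  then have "C \<subseteq> Y" by blast
  obtain H :: "int ^ 'n ^ 'n" where H: "hadamard_matrix H"
    and C: "\<And>c. c \<in> C \<longleftrightarrow>
      (\<exists>i. (\<forall>j. bit_sign (c $ j) = H $ i $ j) \<or> (\<forall>j. bit_sign (c $ j) = - H $ i $ j))"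
    using assms(1) by (rule hadamard_codeE) blast
  define r :: "'n \<Rightarrow> bit ^ 'n" where "r i = (\<chi> j. if H $ i $ j = 1 then 0 else 1)" for i
  have r: "bit_sign (r i $ j) = H $ i $ j" for i j
    using hadamard_matrix_entry[OF H, of i j] by (auto simp: r_def)
  have "inj r"
  proof
    fix i k assume "r i = r k"
    then have "(\<Sum>j\<in>UNIV. H $ i $ j * H $ k $ j) = (\<Sum>j\<in>UNIV. H $ i $ j * H $ i $ j)"
      by (simp flip: r)
    then show "i = k"
      by (simp add: hadamard_matrix_rows[OF H] split: if_splits)
  qed
  have "range r \<subseteq> Y"
    using \<open>C \<subseteq> Y\<close> r C by blast
  then have "card (range r) \<le> card Y"
    using assms(2) by (rule card_mono[rotated])
  then show False
    using assms(3) \<open>inj r\<close> by (simp add: card_image)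
qed

section \<open>The dual code and the rank\<close>

text \<open>
  A linear functional that vanishes on \<open>S\<close> but not at \<open>x\<close> exists by basis extension; \<open>v\<close> is its
  coefficient vector. This turns a statement about orthogonal vectors into one about spans.
\<close>

lemma separating_vector:
  fixes S :: "('a::field ^ 'n) set"
  assumes "x \<notin> vec.span S"
  obtains v where "\<And>y. y \<in> S \<Longrightarrow> (\<Sum>j\<in>UNIV. v $ j * y $ j) = 0" and "(\<Sum>j\<in>UNIV. v $ j * x $ j) = 1"
proof -
  obtain B where B: "B \<subseteq> S" "vec.independent B" "S \<subseteq> vec.span B"
    using vec.maximal_independent_subset by blast
  have "vec.span B \<subseteq> vec.span S"
    using B(1) by (rule vec.span_mono)
  then have x: "x \<notin> vec.span B"
    using assms by blast
  then have "vec.independent (insert x B)"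
    using B(2) by (simp add: vec.independent_insert)
  then obtain f where f: "Vector_Spaces.linear (*s) (*s) f"
    and fB: "\<forall>y\<in>insert x B. f y = (if y = x then 1 else 0 :: 'a ^ 'n)"
    using vec.linear_independent_extend[of "insert x B" "\<lambda>y. if y = x then 1 else 0"] by blast
  \<comment> \<open>\<open>f\<close> takes values in \<open>'a ^ 'n\<close>; any one of its coordinates is the functional wanted.\<close>
  interpret f: Vector_Spaces.linear "(*s)" "(*s)" f by (fact f)
  obtain i :: 'n where True by blast
  define v where "v = matrix f $ i"
  have v: "(\<Sum>j\<in>UNIV. v $ j * y $ j) = f y $ i" for y
    using matrix_works[OF f, of y] by (simp add: v_def matrix_vector_mult_def vec_eq_iff)
  have "f y = 0" if "y \<in> S" for y
  proof (rule f.eq_0_on_span)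
    show "y \<in> vec.span B" using that B(3) by blast
    fix b assume "b \<in> B"
    then have "b \<noteq> x" using x vec.span_base by blast
    then show "f b = 0" using fB \<open>b \<in> B\<close> by simp
  qed
  then show thesis
    using fB by (intro that[of v]) (simp_all add: v)
qed

text \<open>
  The hypothesis fixes the row sums \<open>w\<close> over the support \<open>S\<close> modulo 4. Parseval's identity excludes
  the residue 2, and then the inversion formula, reduced modulo 2, where all entries of \<open>H\<close> coincide,
  shows that the indicator of \<open>S\<close> is constant.
\<close>

lemma hadamard_code_dual:
  fixes C :: "(bit ^ 'n) set"
  assumes C: "hadamard_code C" and "0 \<in> C" and n: "CARD('n) = 4 * t" and "odd t"
    and dual: "\<And>c. c \<in> C \<Longrightarrow> (\<Sum>j\<in>UNIV. v $ j * c $ j) = 0"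
  shows "v = 0 \<or> v = 1"
proof -
  define S where "S = {j. v $ j = 1}"
  have vS: "v $ j = of_bool (j \<in> S)" for j
    by (cases "v $ j") (simp_all add: S_def)
  have onS: "(\<Sum>j\<in>UNIV. v $ j * f j) = (\<Sum>j\<in>S. f j)" for f :: "'n \<Rightarrow> bit"
  proof -
    have "v $ j * f j = (if j \<in> S then f j else 0)" for j
      by (simp add: vS)
    then show ?thesis
      by (simp only: sum.If_cases[OF finite] Int_UNIV_left Collect_mem_eq sum.neutral_const add_0_right)
  qed
  obtain H :: "int ^ 'n ^ 'n" where H: "hadamard_matrix H"
    and C_iff: "\<And>c. c \<in> C \<longleftrightarrow>
      (\<exists>i. (\<forall>j. bit_sign (c $ j) = H $ i $ j) \<or> (\<forall>j. bit_sign (c $ j) = - H $ i $ j))"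
    using C by (rule hadamard_codeE) blast
  define w where "w i = (\<Sum>j\<in>S. H $ i $ j)" for i
  have w_mod: "4 dvd w i - int (card S)" for i
  proof -
    define c :: "bit ^ 'n" where "c = (\<chi> j. if H $ i $ j = 1 then 0 else 1)"
    have c: "bit_sign (c $ j) = H $ i $ j" for j
      using hadamard_matrix_entry[OF H, of i j] by (auto simp: c_def)
    then have "(\<Sum>j\<in>S. c $ j) = 0"
      using dual[of c] C_iff unfolding onS by blast
    then show ?thesis
      by (simp add: sum_eq_0_iff_sum_bit_sign_mod_4 c w_def)
  qed
  have "even (card S)"
  proof -
    have "1 \<in> C"
      using hadamard_code_complement[OF C \<open>0 \<in> C\<close>] by simp
    then have "(\<Sum>j\<in>S. (1::bit)) = 0"
      using dual[of 1] unfolding onS by simp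
    then have "4 dvd - int (card S) - int (card S)"
      by (subst (asm) sum_eq_0_iff_sum_bit_sign_mod_4) simp_all
    then show ?thesis by presburger
  qed
  \<comment> \<open>Applying the transpose of \<open>H\<close> to \<open>w\<close> recovers the indicator of \<open>S\<close> up to the factor \<open>n\<close>.\<close>
  have column: "(\<Sum>i\<in>UNIV. H $ i $ j * w i) = 4 * int t * of_bool (j \<in> S)" for j
  proof -
    have "(\<Sum>i\<in>UNIV. H $ i $ j * w i) = (\<Sum>k\<in>S. \<Sum>i\<in>UNIV. H $ i $ j * H $ i $ k)"
      unfolding w_def sum_distrib_left by (rule sum.swap)
    then show ?thesis
      by (simp add: hadamard_matrix_columns[OF H] n)
  qed
  have parseval: "(\<Sum>i\<in>UNIV. w i * w i) = 4 * int t * int (card S)"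
  proof -
    have "(\<Sum>i\<in>UNIV. w i * w i) = (\<Sum>j\<in>S. \<Sum>i\<in>UNIV. H $ i $ j * w i)"
      by (subst (2) w_def) (simp only: sum_distrib_left sum.swap[of _ S] mult.commute[of "w _"])
    then show ?thesis
      by (simp only: column) (simp add: mult.commute flip: sum_distrib_left)
  qed
  \<comment> \<open>Otherwise each of the \<open>4t\<close> squares is 4 modulo 16, so that their sum is a multiple of 16.\<close>
  have "4 dvd int (card S)"
  proof (rule ccontr)
    assume "\<not> ?thesis"
    have "\<exists>m. w i * w i = 16 * m + 4" for i
    proof -
      have "(w i - 2) mod 4 = 0"
        using w_mod[of i] \<open>even (card S)\<close> \<open>\<not> 4 dvd int (card S)\<close> by presburger
      then obtain q where "w i = 4 * q + 2"
        by (metis add.commute diff_add_cancel mod_0_imp_dvd dvdE)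
      then have "w i * w i = 16 * (q * q + q) + 4"
        by (simp add: algebra_simps)
      then show ?thesis by blast
    qed
    then obtain m where m: "\<And>i. w i * w i = 16 * m i + 4" by metis
    have "4 * int t * int (card S) = (\<Sum>i\<in>UNIV. 16 * m i + 4)"
      using parseval by (simp add: m)
    also have "\<dots> = 16 * ((\<Sum>i\<in>UNIV. m i) + int t)"
      by (simp add: sum.distrib n flip: sum_distrib_left)
    finally have "int t * int (card S) = 4 * ((\<Sum>i\<in>UNIV. m i) + int t)"
      by simp
    then have "4 dvd int t * int (card S)" by simp
    moreover have "coprime 4 (int t)"
      using \<open>odd t\<close> coprime_power_left_iff[of "2::int" 2 "int t"] by simp
    ultimately show False
      using \<open>\<not> 4 dvd int (card S)\<close> by (simp add: coprime_dvd_mult_right_iff)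
  qed
  have "4 dvd w i" for i
    using w_mod[of i] \<open>4 dvd int (card S)\<close> by presburger
  then have "\<forall>i. \<exists>m. w i = 4 * m" by (auto simp: dvd_def)
  then obtain k where k: "\<And>i. w i = 4 * k i" by metis
  \<comment> \<open>The left side does not mention \<open>j\<close>, so \<open>S\<close> is empty or everything.\<close>
  have parity: "even (\<Sum>i\<in>UNIV. k i) \<longleftrightarrow> j \<notin> S" for j
  proof -
    have "4 * (\<Sum>i\<in>UNIV. H $ i $ j * k i) = 4 * (int t * of_bool (j \<in> S))"
      using column[of j] by (simp add: k sum_distrib_left mult_ac)
    then have sum_k: "(\<Sum>i\<in>UNIV. H $ i $ j * k i) = int t * of_bool (j \<in> S)" by simp
    have "even ((H $ i $ j - 1) * k i)" for i
      using hadamard_matrix_entry[OF H, of i j] by auto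
    then have "even (\<Sum>i\<in>UNIV. (H $ i $ j - 1) * k i)"
      by (intro dvd_sum) simp
    then have "even (int t * of_bool (j \<in> S) - (\<Sum>i\<in>UNIV. k i))"
      by (simp add: left_diff_distrib sum_subtractf sum_k)
    then show ?thesis using \<open>odd t\<close> by (cases "j \<in> S") simp_all
  qed
  then show ?thesis
    by (cases "even (\<Sum>i\<in>UNIV. k i)") (simp_all add: vec_eq_iff vS)
qed

lemma hadamard_code_balanced:
  fixes C :: "(bit ^ 'n) set"
  assumes "hadamard_code C" and "0 \<in> C" and "c \<in> C" and "c \<noteq> 0" and "c \<noteq> 1"
  shows "(\<Sum>j\<in>UNIV. bit_sign (c $ j)) = 0"
  using hadamard_code_orthogonal[OF assms(1-3)] assms(4,5) by simp

lemma hadamard_code_even_weight: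
  fixes C :: "(bit ^ 'n) set"
  assumes "hadamard_code C" and "0 \<in> C" and "4 dvd CARD('n)" and "c \<in> C"
  shows "(\<Sum>j\<in>UNIV. c $ j) = 0"
proof -
  have n: "4 dvd int CARD('n)"
    using assms(3) by presburger
  have "4 dvd (\<Sum>j\<in>UNIV. bit_sign (c $ j))"
  proof (cases "c = 0 \<or> c = 1")
    case True
    then show ?thesis using n by auto
  next
    case False
    then show ?thesis
      using hadamard_code_balanced[OF assms(1,2,4)] by simp
  qed
  then show ?thesis
    using n by (simp add: sum_eq_0_iff_sum_bit_sign_mod_4)
qed

text \<open>
  Adjoining a unit vector \<open>e\<close> to \<open>C\<close> raises the dimension by exactly one, since the span of \<open>C\<close> has
  only vectors of even weight. The enlarged set spans the whole space: of the two vectors orthogonal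
  to \<open>C\<close>, only \<open>0\<close> is orthogonal to \<open>e\<close>.
\<close>

lemma hadamard_code_rank:
  fixes C :: "(bit ^ 'n) set"
  assumes C: "hadamard_code C" "0 \<in> C" and n: "CARD('n) = 4 * t" "odd t"
  shows "code_rank C = 4 * t - 1"
proof -
  obtain i :: 'n where True by blast
  define e :: "bit ^ 'n" where "e = axis i 1"
  have sum_e: "(\<Sum>j\<in>UNIV. v $ j * e $ j) = v $ i" for v :: "bit ^ 'n"
    by (simp add: e_def axis_def if_distrib cong: if_cong)
  have "vec.span C \<subseteq> {x. (\<Sum>j\<in>UNIV. x $ j) = 0}"
  proof (rule vec.span_minimal)
    show "C \<subseteq> {x. (\<Sum>j\<in>UNIV. x $ j) = 0}"
      using hadamard_code_even_weight[OF C] n(1) by auto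
    show "vec.subspace {x :: bit ^ 'n. (\<Sum>j\<in>UNIV. x $ j) = 0}"
    proof (rule vec.subspaceI; unfold mem_Collect_eq)
      fix x y :: "bit ^ 'n" and a :: bit
      assume x: "(\<Sum>j\<in>UNIV. x $ j) = 0"
      have "(\<Sum>j\<in>UNIV. (a *s x) $ j) = a * (\<Sum>j\<in>UNIV. x $ j)"
        by (simp only: vector_smult_component sum_distrib_left)
      with x show "(\<Sum>j\<in>UNIV. (a *s x) $ j) = 0" by simp
      assume "(\<Sum>j\<in>UNIV. y $ j) = 0"
      with x show "(\<Sum>j\<in>UNIV. (x + y) $ j) = 0"
        by (simp only: vector_add_component sum.distrib) simp
    qed simp
  qed
  moreover have "(\<Sum>j\<in>UNIV. e $ j) = 1"
    using sum_e[of 1] by (simp only: one_index mult_1)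
  ultimately have "e \<notin> vec.span C"
    by auto
  then have dim_e: "vec.dim (insert e C) = vec.dim C + 1"
    by (simp add: vec.dim_insert)
  have "x \<in> vec.span (insert e C)" for x
  proof (rule ccontr)
    assume "x \<notin> vec.span (insert e C)"
    then obtain v where v: "\<And>y. y \<in> insert e C \<Longrightarrow> (\<Sum>j\<in>UNIV. v $ j * y $ j) = 0"
      and vx: "(\<Sum>j\<in>UNIV. v $ j * x $ j) = 1"
      by (rule separating_vector) blast
    have "v = 0 \<or> v = 1"
      using C n by (rule hadamard_code_dual) (rule v, blast)
    moreover have "v $ i = 0"
      using v[of e] unfolding sum_e by blast
    ultimately show False
      using vx by auto
  qed
  then have "vec.span (insert e C) = UNIV"
    by blast
  then have "vec.dim (insert e C) = CARD('n)"
    by (metis vec.dim_span vec.dim_UNIV vec_dim_card)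
  then show ?thesis
    using dim_e n(1) by (simp add: code_rank_def)
qed

section \<open>The kernel\<close>

text \<open>
  For \<open>z\<close> in the kernel, \<open>c + z\<close> is again a codeword, so besides \<open>z\<close>, \<open>c\<close>, \<open>c'\<close> and their pairwise
  sums also the triple sum \<open>z + c + c'\<close> is balanced. No four vectors \<open>0, z, c, c'\<close> can have this
  property when 8 does not divide the length.
\<close>

lemma hadamard_code_kernel:
  fixes C :: "(bit ^ 'n) set"
  assumes C: "hadamard_code C" "0 \<in> C" and n: "CARD('n) = 4 * t" "odd t" "t \<noteq> 1"
  shows "code_kernel C = {0, 1}"
proof
  have "(\<lambda>c. c + 1) ` C = C"
  proof
    show "(\<lambda>c. c + 1) ` C \<subseteq> C"
      using hadamard_code_complement[OF C(1)] by blast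
    have "c = (c + 1) + 1" for c :: "bit ^ 'n"
      by (simp add: vec_eq_iff add.assoc)
    then show "C \<subseteq> (\<lambda>c. c + 1) ` C"
      using hadamard_code_complement[OF C(1)] by blast
  qed
  then show "{0, 1} \<subseteq> code_kernel C"
    by (simp add: code_kernel_def)
  show "code_kernel C \<subseteq> {0, 1}"
  proof
    fix z assume "z \<in> code_kernel C"
    then have shift: "c + z \<in> C" if "c \<in> C" for c
      using that by (auto simp: code_kernel_def)
    then have "z \<in> C"
      using C(2) by fastforce
    show "z \<in> {0, 1}"
    proof (rule ccontr)
      assume z: "z \<notin> {0, 1}"
      have "3 \<le> t" using n(2,3) by presburger
      then have big: "12 \<le> CARD('n)" using n(1) by simp
      \<comment> \<open>At most 4 and at most 8 vectors have to be avoided, fewer than the length \<open>4t\<close>.\<close>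
      define X where "X = set [0, 1, z, z + 1]"
      have "finite X" "card X < CARD('n)"
        using card_length[of "[0, 1, z, z + 1]"] big by (simp_all only: X_def finite_set) simp
      then obtain c where c: "c \<in> C" "c \<notin> X"
        using hadamard_code_element_outside[OF C(1)] by blast
      define Y where "Y = set [0, 1, z, z + 1, c, c + 1, c + z, c + z + 1]"
      have "finite Y" "card Y < CARD('n)"
        using card_length[of "[0, 1, z, z + 1, c, c + 1, c + z, c + z + 1]"] big
        by (simp_all only: Y_def finite_set) simp
      then obtain c' where c': "c' \<in> C" "c' \<notin> Y"
        using hadamard_code_element_outside[OF C(1)] by blast
      have ne: "z \<noteq> 0" "z \<noteq> 1" "c \<noteq> 0" "c \<noteq> 1" "c \<noteq> z" "c \<noteq> z + 1"
        "c' \<noteq> 0" "c' \<noteq> 1" "c' \<noteq> z" "c' \<noteq> z + 1" "c' \<noteq> c" "c' \<noteq> c + 1"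
        "c' \<noteq> c + z" "c' \<noteq> c + z + 1"
        using z c(2) c'(2) unfolding X_def Y_def list.set by blast+
      let ?s = "\<lambda>x j. bit_sign (x $ j)"
      note balanced = hadamard_code_balanced[OF C]
      note orth = hadamard_code_orthogonal[OF C(1)]
      have s3: "(\<Sum>j\<in>UNIV. ?s c j * ?s z j * ?s c' j) = 0"
        using orth[OF shift[OF c(1)] c'(1) ne(13,14)]
        by (simp only: vector_add_component bit_sign_add)
      have "(1 + ?s z j) * (1 + ?s c j) * (1 + ?s c' j)
          = 1 + ?s z j + ?s c j + ?s c' j + ?s z j * ?s c j + ?s z j * ?s c' j
            + ?s c j * ?s c' j + ?s c j * ?s z j * ?s c' j" for j
        by (simp only: ring_distribs mult_1_left mult_1_right ac_simps)
      then have "(\<Sum>j\<in>UNIV. (1 + ?s z j) * (1 + ?s c j) * (1 + ?s c' j)) = (\<Sum>j\<in>(UNIV::'n set). 1)"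
        by (simp only: sum.distrib s3 balanced[OF \<open>z \<in> C\<close> ne(1,2)] balanced[OF c(1) ne(3,4)]
          balanced[OF c'(1) ne(7,8)] orth[OF \<open>z \<in> C\<close> c(1) ne(5,6)]
          orth[OF \<open>z \<in> C\<close> c'(1) ne(9,10)] orth[OF c(1) c'(1) ne(11,12)] add_0_right)
      moreover have "8 dvd (1 + ?s z j) * (1 + ?s c j) * (1 + ?s c' j)" for j
        by (cases "z $ j"; cases "c $ j"; cases "c' $ j") simp_all
      then have "8 dvd (\<Sum>j\<in>UNIV. (1 + ?s z j) * (1 + ?s c j) * (1 + ?s c' j))"
        by (intro dvd_sum) simp
      ultimately have "8 dvd int CARD('n)"
        by simp
      then show False
        using n(1,2) by presburger
    qed
  qed
qed

theorem proposition3p28: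
  fixes C :: "(bit ^ 'n) set" and \<pi> :: "bit ^ 'n \<Rightarrow> 'n \<Rightarrow> 'n" and t :: nat
  assumes "HFP_Qu_code t \<pi> C"
    and "odd t"
  shows "code_rank C = 4 * t - 1 \<and> (t \<noteq> 1 \<longrightarrow> vec.dim (code_kernel C) = 1)"
proof -
  have C: "hadamard_code C" "0 \<in> C" and n: "CARD('n) = 4 * t"
    using assms(1) by (auto simp: HFP_Qu_code_def HFP_code_def)
  have "vec.dim {0, 1 :: bit ^ 'n} = 1"
    by (simp add: vec.dim_insert vec.span_zero)
  then show ?thesis
    using hadamard_code_rank[OF C n assms(2)] hadamard_code_kernel[OF C n assms(2)] by auto
qed

end
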